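(* For every integer $k\ge1$ and every $s=1,\dots,k$, $$C_{\underbrace{0,\dots,0}_{s-1},1}^{s,1,k+1}=\binom{k+1}{s+1}.$$
   Context: For integers $k\ge1$, $1\le s\le k-1$, $1\le m\le s$ and nonnegative integers $\alpha_1,\dots,\alpha_s$ with $\sum_{i=1}^s\alpha_i=m$, $\sum_{i=1}^s i\alpha_i=s$, the numbers $C_{\alpha_1,\dots,\alpha_s}^{s,m,k}$ are the uniquely determined universal numbers (not depending on $u$) such that for every entire or meromorphic function $u$ on $\mathbb{C}$ the operator $A=u(z)\frac{d}{dz}$ satisfies $$A^{k}=u^k\Big(\frac{d}{dz}\Big)^k+\sum_{s=1}^{k-1}\Big(\sum_{m=1}^{s}u^{k-m}\sum_{m,s}C_{\alpha_1,\dots,\alpha_s}^{s,m,k}\Big(\frac{du}{dz}\Big)^{\alpha_1}\cdots\Big(\frac{d^su}{dz^s}\Big)^{\alpha_s}\Big)\Big(\frac{d}{dz}\Big)^{k-s},$$ where $\sum_{m,s}$ is over all nonnegative integers $\alpha_1,\dots,\alpha_s$ with $\sum_{i=1}^s\alpha_i=m$ and $\sum_{i=1}^s i\alpha_i=s$. *)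

theory Defs
  imports "HOL-Complex_Analysis.Complex_Analysis"
begin

definition vf_op :: "(complex \<Rightarrow> complex) \<Rightarrow> (complex \<Rightarrow> complex) \<Rightarrow> complex \<Rightarrow> complex" where
  "vf_op u f = (\<lambda>z. u z * deriv f z)"

text \<open>
  A tuple $(\alpha_1,\dots,\alpha_s)$ is encoded as a function on \<^typ>\<open>nat\<close> that vanishes outside
  \<open>{1..s}\<close>. The set below is therefore finite, so sums over it are genuine.
\<close>
definition multi_indices :: "nat \<Rightarrow> nat \<Rightarrow> (nat \<Rightarrow> nat) set" where
  "multi_indices s m = {\<alpha>. (\<forall>i. i \<notin> {1..s} \<longrightarrow> \<alpha> i = 0)
     \<and> (\<Sum>i=1..s. \<alpha> i) = m \<and> (\<Sum>i=1..s. i * \<alpha> i) = s}"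

text \<open>
  The identity for the $k$-th power of $A = u\,d/dz$ is an identity of operators on meromorphic
  functions. In HOL a meromorphic function is total, with arbitrary values on a discrete set, so
  equality of the two sides is required at every point where \<open>u\<close> and the argument \<open>f\<close> are both
  analytic; for entire \<open>u\<close> and \<open>f\<close> this is every point of the plane.
\<close>
definition universal_coeffs :: "nat \<Rightarrow> (nat \<Rightarrow> nat \<Rightarrow> (nat \<Rightarrow> nat) \<Rightarrow> complex) \<Rightarrow> bool" where
  "universal_coeffs k C \<longleftrightarrow>
    (\<forall>u f z. u meromorphic_on UNIV \<longrightarrow> f meromorphic_on UNIV \<longrightarrow>
       u analytic_on {z} \<longrightarrow> f analytic_on {z} \<longrightarrow>
       (vf_op u ^^ k) f z =
         u z ^ k * (deriv ^^ k) f z +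
         (\<Sum>s=1..k-1.
            (\<Sum>m=1..s. u z ^ (k - m) *
               (\<Sum>\<alpha>\<in>multi_indices s m. C s m \<alpha> * (\<Prod>i=1..s. ((deriv ^^ i) u z) ^ \<alpha> i))) *
            (deriv ^^ (k - s)) f z))"

text \<open>
  \<open>op_coeff k s m \<alpha>\<close> is $C^{s,m,k}_{\alpha_1,\dots,\alpha_s}$. Only the values at admissible indices
  carry meaning; setting the others to \<open>0\<close> makes the family unique as a total function.
\<close>
definition op_coeff :: "nat \<Rightarrow> nat \<Rightarrow> nat \<Rightarrow> (nat \<Rightarrow> nat) \<Rightarrow> complex" where
  "op_coeff k = (THE C. universal_coeffs k C \<and>
     (\<forall>s m \<alpha>. \<not> (1 \<le> s \<and> s \<le> k - 1 \<and> 1 \<le> m \<and> m \<le> s \<and> \<alpha> \<in> multi_indices s m)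
        \<longrightarrow> C s m \<alpha> = 0))"

end

theory Submission
  imports Defs
begin

text \<open>
  Writing \<open>A ^ (n + 1)\<close> as the sum of \<open>T n s * D ^ (n + 1 - s)\<close> over \<open>s \<le> n\<close>, with \<open>D = d/dz\<close>,
  one more application of \<open>A = u D\<close> gives \<open>T (n + 1) s = u * T n s + u * D (T n (s - 1))\<close>. Hence
  \<open>T n s\<close> is a differential polynomial in \<open>u\<close> of degree \<open>n + 1\<close> and weight \<open>s\<close>, and its coefficients
  obey a recursion; for the monomial \<open>u ^ n * D ^ s u\<close> this recursion is Pascal's rule. Since a
  polynomial \<open>u\<close> can have any prescribed finite jet at \<open>0\<close>, and monomials in finitely many variables
  are linearly independent as functions, the universal coefficients are unique, and so they are the
  ones produced by the recursion.
\<close>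

section \<open>Exponent vectors and their degree and weight\<close>

definition inc :: "nat \<Rightarrow> (nat \<Rightarrow> nat) \<Rightarrow> nat \<Rightarrow> nat" where
  "inc j \<alpha> = \<alpha>(j := Suc (\<alpha> j))"

definition dec :: "nat \<Rightarrow> (nat \<Rightarrow> nat) \<Rightarrow> nat \<Rightarrow> nat" where
  "dec j \<alpha> = \<alpha>(j := \<alpha> j - 1)"

lemma dec_inc [simp]: "dec j (inc j \<alpha>) = \<alpha>"
  by (simp add: inc_def dec_def)

lemma inc_dec [simp]: "\<alpha> j > 0 \<Longrightarrow> inc j (dec j \<alpha>) = \<alpha>"
  by (simp add: inc_def dec_def)

lemma inc_same [simp]: "inc j \<alpha> j = Suc (\<alpha> j)"
  by (simp add: inc_def)

text \<open>Used with the weights \<open>1\<close> and \<open>i\<close>, for the change of degree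
  and of weight under \<open>inc\<close>.\<close>

lemma sum_inc:
  fixes w :: "nat \<Rightarrow> nat"
  assumes "finite A" "j \<in> A"
  shows "(\<Sum>i\<in>A. w i * inc j \<alpha> i) = w j + (\<Sum>i\<in>A. w i * \<alpha> i)"
proof -
  have "(\<Sum>i\<in>A. w i * inc j \<alpha> i) = (\<Sum>i\<in>A. (if i = j then w i else 0) + w i * \<alpha> i)"
    by (intro sum.cong) (auto simp: inc_def)
  also have "\<dots> = w j + (\<Sum>i\<in>A. w i * \<alpha> i)"
    using assms by (simp add: sum.distrib)
  finally show ?thesis .
qed

lemma prod_inc:
  fixes g :: "nat \<Rightarrow> 'a :: comm_monoid_mult"
  assumes "finite A" "j \<in> A"
  shows "(\<Prod>i\<in>A. g i ^ inc j \<alpha> i) = g j * (\<Prod>i\<in>A. g i ^ \<alpha> i)"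
proof -
  have "(\<Prod>i\<in>A. g i ^ inc j \<alpha> i) = (\<Prod>i\<in>A. (if i = j then g i else 1) * g i ^ \<alpha> i)"
    by (intro prod.cong) (auto simp: inc_def)
  also have "\<dots> = g j * (\<Prod>i\<in>A. g i ^ \<alpha> i)"
    using assms by (simp add: prod.distrib)
  finally show ?thesis .
qed

text \<open>
  Unlike in \<^const>\<open>multi_indices\<close>, the entry at \<open>0\<close> is used here: it is the exponent of \<open>u\<close> itself, so
  that the truncated difference \<open>k - m\<close> does not occur.
\<close>
definition exponents :: "nat \<Rightarrow> nat \<Rightarrow> (nat \<Rightarrow> nat) set" where
  "exponents d s = {\<alpha>. (\<forall>i>s. \<alpha> i = 0) \<and> (\<Sum>i\<le>s. \<alpha> i) = d \<and> (\<Sum>i\<le>s. i * \<alpha> i) = s}"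

lemma exponents_inc_0: "inc 0 \<gamma> \<in> exponents (Suc d) s \<longleftrightarrow> \<gamma> \<in> exponents d s"
  using sum_inc[of "{..s}" 0 "\<lambda>_. 1" \<gamma>] sum_inc[of "{..s}" 0 "\<lambda>i. i" \<gamma>]
  by (auto simp: exponents_def inc_def)

text \<open>Turning one factor \<open>D ^ j u\<close> into \<open>D ^ (j + 1) u\<close> keeps the
  degree and raises the weight by one. The vector \<open>\<gamma>\<close> of the untouched factors
  makes the move symmetric.\<close>

lemma exponents_inc_Suc:
  assumes "j \<le> s"
  shows "inc (Suc j) \<gamma> \<in> exponents d (Suc s) \<longleftrightarrow> inc j \<gamma> \<in> exponents d s"
proof -
  have 1: "(\<Sum>i\<le>Suc s. inc (Suc j) \<gamma> i) = Suc (\<Sum>i\<le>s. \<gamma> i) + \<gamma> (Suc s)"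
    using sum_inc[of "{..Suc s}" "Suc j" "\<lambda>_. 1" \<gamma>] assms by simp
  have 2: "(\<Sum>i\<le>Suc s. i * inc (Suc j) \<gamma> i) = Suc j + (\<Sum>i\<le>s. i * \<gamma> i) + Suc s * \<gamma> (Suc s)"
    using sum_inc[of "{..Suc s}" "Suc j" "\<lambda>i. i" \<gamma>] assms by simp
  have 3: "(\<Sum>i\<le>s. inc j \<gamma> i) = Suc (\<Sum>i\<le>s. \<gamma> i)"
    using sum_inc[of "{..s}" j "\<lambda>_. 1" \<gamma>] assms by simp
  have 4: "(\<Sum>i\<le>s. i * inc j \<gamma> i) = j + (\<Sum>i\<le>s. i * \<gamma> i)"
    using sum_inc[of "{..s}" j "\<lambda>i. i" \<gamma>] assms by simp
  \<comment> \<open>The supports allowed on the two sides differ at the index \<open>Suc s\<close>.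
    A positive entry of \<open>\<gamma>\<close> there would alone use up the weight
    \<open>Suc s\<close>, leaving nothing for \<open>Suc j\<close>.\<close>
  have 5: "\<gamma> (Suc s) = 0" if "Suc j + (\<Sum>i\<le>s. i * \<gamma> i) + Suc s * \<gamma> (Suc s) = Suc s"
    using that by (cases "\<gamma> (Suc s)") auto
  have 6: "(\<forall>i>Suc s. inc (Suc j) \<gamma> i = 0) \<longleftrightarrow> (\<forall>i>Suc s. \<gamma> i = 0)"
    using assms by (auto simp: inc_def)
  have 7: "(\<forall>i>s. inc j \<gamma> i = 0) \<longleftrightarrow> (\<forall>i>s. \<gamma> i = 0)"
    using assms by (auto simp: inc_def)
  have 8: "(\<forall>i>s. \<gamma> i = 0) \<longleftrightarrow> \<gamma> (Suc s) = 0 \<and> (\<forall>i>Suc s. \<gamma> i = 0)"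
    by (metis Suc_lessI lessI less_SucI Suc_lessD)
  show ?thesis
    unfolding exponents_def mem_Collect_eq 1 2 3 4 6 7 8 using 5 by auto
qed

lemma finite_exponents: "finite (exponents d s)"
proof (rule finite_subset)
  show "exponents d s \<subseteq> {\<alpha>. \<forall>i. (i \<in> {..s} \<longrightarrow> \<alpha> i \<in> {..d}) \<and> (i \<notin> {..s} \<longrightarrow> \<alpha> i = 0)}"
    by (auto simp: exponents_def intro: member_le_sum)
qed (rule finite_set_of_finite_funs; simp)

section \<open>Differential polynomials: product with \<open>u\<close> and derivative\<close>

definition jet_monomial :: "nat \<Rightarrow> (nat \<Rightarrow> nat) \<Rightarrow> (complex \<Rightarrow> complex) \<Rightarrow> complex \<Rightarrow> complex" where
  "jet_monomial s \<alpha> u z = (\<Prod>i\<le>s. ((deriv ^^ i) u z) ^ \<alpha> i)"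

definition diff_poly ::
  "nat \<Rightarrow> nat \<Rightarrow> ((nat \<Rightarrow> nat) \<Rightarrow> complex) \<Rightarrow> (complex \<Rightarrow> complex) \<Rightarrow> complex \<Rightarrow> complex" where
  "diff_poly d s c u z = (\<Sum>\<alpha>\<in>exponents d s. c \<alpha> * jet_monomial s \<alpha> u z)"

definition mult_coeff :: "((nat \<Rightarrow> nat) \<Rightarrow> complex) \<Rightarrow> (nat \<Rightarrow> nat) \<Rightarrow> complex" where
  "mult_coeff c \<beta> = (if \<beta> 0 = 0 then 0 else c (dec 0 \<beta>))"

text \<open>
  The derivative of the monomial \<open>\<alpha>\<close> is the sum over \<open>j\<close> of \<open>\<alpha> j\<close> times the monomial in which one
  factor \<open>D ^ j u\<close> has become \<open>D ^ (j + 1) u\<close>; collecting the contributions to a monomial \<open>\<beta>\<close> means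
  undoing that move.
\<close>
definition deriv_coeff :: "nat \<Rightarrow> ((nat \<Rightarrow> nat) \<Rightarrow> complex) \<Rightarrow> (nat \<Rightarrow> nat) \<Rightarrow> complex" where
  "deriv_coeff s c \<beta> = (\<Sum>j\<le>s. if \<beta> (Suc j) = 0 then 0
     else let \<alpha> = inc j (dec (Suc j) \<beta>) in of_nat (\<alpha> j) * c \<alpha>)"

text \<open>The map \<open>inc 0\<close> is a bijection onto the exponent vectors with a positive
  entry at \<open>0\<close>; on the remaining vectors \<open>mult_coeff\<close> is
  \<open>0\<close>.\<close>

lemma diff_poly_mult: "u z * diff_poly d s c u z = diff_poly (Suc d) s (mult_coeff c) u z"
proof -
  have "diff_poly (Suc d) s (mult_coeff c) u z =
      (\<Sum>\<beta>\<in>{\<beta>\<in>exponents (Suc d) s. \<beta> 0 > 0}. c (dec 0 \<beta>) * jet_monomial s \<beta> u z)"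
    unfolding diff_poly_def using finite_exponents
    by (intro sum.mono_neutral_cong_right) (auto simp: mult_coeff_def)
  also have "\<dots> = (\<Sum>\<alpha>\<in>exponents d s. u z * (c \<alpha> * jet_monomial s \<alpha> u z))"
  proof (rule sum.reindex_bij_witness[of _ "inc 0" "dec 0"])
    fix \<beta> assume "\<beta> \<in> {\<beta>\<in>exponents (Suc d) s. \<beta> 0 > 0}"
    then obtain \<gamma> where \<beta>: "\<beta> = inc 0 \<gamma>" and "inc 0 \<gamma> \<in> exponents (Suc d) s"
      by (metis (mono_tags, lifting) inc_dec mem_Collect_eq)
    then show "inc 0 (dec 0 \<beta>) = \<beta>" "dec 0 \<beta> \<in> exponents d s"
      by (auto simp: exponents_inc_0)
    show "u z * (c (dec 0 \<beta>) * jet_monomial s (dec 0 \<beta>) u z) = c (dec 0 \<beta>) * jet_monomial s \<beta> u z"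
      by (simp add: \<beta> jet_monomial_def prod_inc)
  qed (auto simp: exponents_inc_0)
  finally show ?thesis by (simp add: diff_poly_def sum_distrib_left)
qed

text \<open>This is the product rule. Where \<open>\<alpha> j = 0\<close>, the truncated exponent
  \<open>\<alpha> j - 1\<close> is multiplied by \<open>of_nat (\<alpha> j) = 0\<close>.\<close>

lemma jet_monomial_has_derivative:
  assumes "u analytic_on {z}" "\<alpha> (Suc s) = 0"
  shows "(jet_monomial s \<alpha> u has_field_derivative
           (\<Sum>j\<le>s. of_nat (\<alpha> j) * jet_monomial (Suc s) (inc (Suc j) (dec j \<alpha>)) u z)) (at z)"
proof -
  let ?g = "\<lambda>i. (deriv ^^ i) u z"
  have d: "((deriv ^^ i) u has_field_derivative ?g (Suc i)) (at z)" for i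
    using analytic_higher_deriv[OF assms(1), of i]
    by (simp add: analytic_on_imp_differentiable_at DERIV_deriv_iff_field_differentiable)
  have "(jet_monomial s \<alpha> u has_field_derivative
          (\<Sum>j\<le>s. (of_nat (\<alpha> j) * (?g (Suc j) * ?g j ^ (\<alpha> j - Suc 0))) *
              (\<Prod>i\<in>{..s} - {j}. ?g i ^ \<alpha> i))) (at z)"
    unfolding jet_monomial_def[abs_def]
    by (rule has_field_derivative_prod) (rule DERIV_power[OF d])
  also have "(\<Sum>j\<le>s. (of_nat (\<alpha> j) * (?g (Suc j) * ?g j ^ (\<alpha> j - Suc 0))) *
              (\<Prod>i\<in>{..s} - {j}. ?g i ^ \<alpha> i)) =
       (\<Sum>j\<le>s. of_nat (\<alpha> j) * jet_monomial (Suc s) (inc (Suc j) (dec j \<alpha>)) u z)"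
  proof (rule sum.cong)
    fix j assume j: "j \<in> {..s}"
    have "jet_monomial (Suc s) (inc (Suc j) (dec j \<alpha>)) u z =
            ?g (Suc j) * (\<Prod>i\<le>Suc s. ?g i ^ dec j \<alpha> i)"
      unfolding jet_monomial_def using j by (intro prod_inc) auto
    \<comment> \<open>The factor at \<open>Suc s\<close> is \<open>1\<close>, because
      \<open>\<alpha>\<close> vanishes there.\<close>
    also have "(\<Prod>i\<le>Suc s. ?g i ^ dec j \<alpha> i) = (\<Prod>i\<le>s. ?g i ^ dec j \<alpha> i)"
      using j assms(2) by (simp add: dec_def)
    also have "\<dots> = ?g j ^ (\<alpha> j - 1) * (\<Prod>i\<in>{..s} - {j}. ?g i ^ \<alpha> i)"
      using j by (subst prod.remove[of _ j]) (auto simp: dec_def intro!: prod.cong)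
    finally show "(of_nat (\<alpha> j) * (?g (Suc j) * ?g j ^ (\<alpha> j - Suc 0))) * (\<Prod>i\<in>{..s} - {j}. ?g i ^ \<alpha> i) =
        of_nat (\<alpha> j) * jet_monomial (Suc s) (inc (Suc j) (dec j \<alpha>)) u z"
      by (simp add: mult_ac)
  qed simp
  finally show ?thesis .
qed

text \<open>For fixed \<open>j\<close> the move from \<open>j\<close> to \<open>j + 1\<close> is a
  bijection between the vectors with a positive entry at \<open>j\<close> and those with a positive
  entry at \<open>j + 1\<close>. The sum over \<open>j\<close> is therefore pulled outside before
  reindexing.\<close>

lemma diff_poly_has_derivative:
  assumes "u analytic_on {z}"
  shows "(diff_poly d s c u has_field_derivative diff_poly d (Suc s) (deriv_coeff s c) u z) (at z)"
proof -
  let ?M = "\<lambda>\<beta>. jet_monomial (Suc s) \<beta> u z"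
  let ?a = "\<lambda>j \<beta>. inc j (dec (Suc j) \<beta>)"
  have "(diff_poly d s c u has_field_derivative
      (\<Sum>\<alpha>\<in>exponents d s. c \<alpha> * (\<Sum>j\<le>s. of_nat (\<alpha> j) * ?M (inc (Suc j) (dec j \<alpha>))))) (at z)"
    unfolding diff_poly_def[abs_def]
    by (intro DERIV_sum DERIV_cmult jet_monomial_has_derivative assms) (auto simp: exponents_def)
  also have "(\<Sum>\<alpha>\<in>exponents d s. c \<alpha> * (\<Sum>j\<le>s. of_nat (\<alpha> j) * ?M (inc (Suc j) (dec j \<alpha>)))) =
      (\<Sum>j\<le>s. \<Sum>\<alpha>\<in>exponents d s. of_nat (\<alpha> j) * c \<alpha> * ?M (inc (Suc j) (dec j \<alpha>)))"
    unfolding sum_distrib_left by (subst sum.swap) (simp add: mult_ac)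
  also have "\<dots> = (\<Sum>j\<le>s. \<Sum>\<beta>\<in>exponents d (Suc s).
      (if \<beta> (Suc j) = 0 then 0 else of_nat (?a j \<beta> j) * c (?a j \<beta>)) * ?M \<beta>)"
  proof (rule sum.cong)
    fix j assume "j \<in> {..s}"
    then have j: "j \<le> s" by simp
    have "(\<Sum>\<alpha>\<in>exponents d s. of_nat (\<alpha> j) * c \<alpha> * ?M (inc (Suc j) (dec j \<alpha>))) =
        (\<Sum>\<alpha>\<in>{\<alpha>\<in>exponents d s. \<alpha> j > 0}. of_nat (\<alpha> j) * c \<alpha> * ?M (inc (Suc j) (dec j \<alpha>)))"
      using finite_exponents by (intro sum.mono_neutral_right) auto
    also have "\<dots> = (\<Sum>\<beta>\<in>{\<beta>\<in>exponents d (Suc s). \<beta> (Suc j) > 0}.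
        of_nat (?a j \<beta> j) * c (?a j \<beta>) * ?M \<beta>)"
    proof (rule sum.reindex_bij_witness[of _ "?a j" "\<lambda>\<alpha>. inc (Suc j) (dec j \<alpha>)"])
      fix \<alpha> assume "\<alpha> \<in> {\<alpha>\<in>exponents d s. \<alpha> j > 0}"
      then obtain \<gamma> where "\<alpha> = inc j \<gamma>" "inc j \<gamma> \<in> exponents d s"
        by (metis (mono_tags, lifting) inc_dec mem_Collect_eq)
      then show "?a j (inc (Suc j) (dec j \<alpha>)) = \<alpha>"
        "inc (Suc j) (dec j \<alpha>) \<in> {\<beta>\<in>exponents d (Suc s). \<beta> (Suc j) > 0}"
        "of_nat (?a j (inc (Suc j) (dec j \<alpha>)) j) * c (?a j (inc (Suc j) (dec j \<alpha>))) *
           ?M (inc (Suc j) (dec j \<alpha>)) = of_nat (\<alpha> j) * c \<alpha> * ?M (inc (Suc j) (dec j \<alpha>))"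
        using j by (auto simp: exponents_inc_Suc)
    next
      fix \<beta> assume "\<beta> \<in> {\<beta>\<in>exponents d (Suc s). \<beta> (Suc j) > 0}"
      then obtain \<gamma> where "\<beta> = inc (Suc j) \<gamma>" "inc (Suc j) \<gamma> \<in> exponents d (Suc s)"
        by (metis (mono_tags, lifting) inc_dec mem_Collect_eq)
      then show "inc (Suc j) (dec j (?a j \<beta>)) = \<beta>" "?a j \<beta> \<in> {\<alpha>\<in>exponents d s. \<alpha> j > 0}"
        using j by (auto simp: exponents_inc_Suc)
    qed
    also have "\<dots> = (\<Sum>\<beta>\<in>exponents d (Suc s).
        (if \<beta> (Suc j) = 0 then 0 else of_nat (?a j \<beta> j) * c (?a j \<beta>)) * ?M \<beta>)"
      using finite_exponents by (intro sum.mono_neutral_cong_left) auto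
    finally show "(\<Sum>\<alpha>\<in>exponents d s. of_nat (\<alpha> j) * c \<alpha> * ?M (inc (Suc j) (dec j \<alpha>))) = \<dots>" .
  qed simp
  also have "\<dots> = diff_poly d (Suc s) (deriv_coeff s c) u z"
    unfolding diff_poly_def deriv_coeff_def Let_def sum_distrib_right by (rule sum.swap)
  finally show ?thesis .
qed

section \<open>Coefficients of the powers of \<open>A\<close>\<close>

text \<open>The first argument is shifted: \<open>power_coeff n\<close> belongs to the power \<open>A ^ (n + 1)\<close>.\<close>
fun power_coeff :: "nat \<Rightarrow> nat \<Rightarrow> (nat \<Rightarrow> nat) \<Rightarrow> complex" where
  "power_coeff 0 s = (\<lambda>_. if s = 0 then 1 else 0)"
| "power_coeff (Suc n) 0 = mult_coeff (power_coeff n 0)"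
| "power_coeff (Suc n) (Suc s) =
     mult_coeff (\<lambda>\<beta>. power_coeff n (Suc s) \<beta> + deriv_coeff s (power_coeff n s) \<beta>)"

text \<open>The index \<open>s\<close> starts at \<open>0\<close> and grows by at most one with each
  further factor \<open>A\<close>.\<close>

lemma power_coeff_eq_0: "n < s \<Longrightarrow> power_coeff n s \<beta> = 0"
  by (induction n s arbitrary: \<beta> rule: power_coeff.induct)
     (auto simp: mult_coeff_def deriv_coeff_def Let_def intro!: sum.neutral)

lemma diff_poly_add: "diff_poly d s (\<lambda>\<beta>. c \<beta> + c' \<beta>) u z = diff_poly d s c u z + diff_poly d s c' u z"
  by (simp add: diff_poly_def sum.distrib ring_distribs)

text \<open>The formula is proved on an open set because the induction step differentiates
  it.\<close>

lemma vf_op_power: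
  assumes "open S" "u holomorphic_on S" "f holomorphic_on S" "z \<in> S"
  shows "(vf_op u ^^ Suc n) f z =
           (\<Sum>s\<le>n. diff_poly (Suc n) s (power_coeff n s) u z * (deriv ^^ (Suc n - s)) f z)"
  using assms(4)
proof (induction n arbitrary: z)
  case 0
  have "exponents (Suc 0) 0 = {\<lambda>i. if i = 0 then 1 else 0}"
    by (auto simp: exponents_def)
  then show ?case
    by (simp add: vf_op_def diff_poly_def jet_monomial_def)
next
  case (Suc n)
  let ?T = "\<lambda>s. diff_poly (Suc n) s (power_coeff n s) u"
  let ?T' = "\<lambda>s. diff_poly (Suc n) (Suc s) (deriv_coeff s (power_coeff n s)) u"
  have an: "u analytic_on {z}" "f analytic_on {z}"
    using assms(1-3) Suc.prems analytic_on_holomorphic by blast+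
  have f: "((deriv ^^ i) f has_field_derivative (deriv ^^ Suc i) f z) (at z)" for i
    using analytic_higher_deriv[OF an(2), of i]
    by (simp add: analytic_on_imp_differentiable_at DERIV_deriv_iff_field_differentiable)
  have "((\<lambda>z. \<Sum>s\<le>n. ?T s z * (deriv ^^ (Suc n - s)) f z) has_field_derivative
      (\<Sum>s\<le>n. ?T' s z * (deriv ^^ (Suc n - s)) f z + (deriv ^^ Suc (Suc n - s)) f z * ?T s z)) (at z)"
    by (intro DERIV_sum DERIV_mult diff_poly_has_derivative an f)
  moreover have "\<forall>\<^sub>F w in nhds z. (vf_op u ^^ Suc n) f w = (\<Sum>s\<le>n. ?T s w * (deriv ^^ (Suc n - s)) f w)"
    using Suc.IH assms(1) Suc.prems by (auto simp: eventually_nhds)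
  ultimately have "deriv ((vf_op u ^^ Suc n) f) z =
      (\<Sum>s\<le>n. ?T' s z * (deriv ^^ (Suc n - s)) f z + (deriv ^^ Suc (Suc n - s)) f z * ?T s z)"
    by (subst deriv_cong_ev[OF _ refl]) (assumption, rule DERIV_imp_deriv)
  then have "(vf_op u ^^ Suc (Suc n)) f z =
      (\<Sum>s\<le>n. u z * ?T' s z * (deriv ^^ (Suc n - s)) f z) +
      (\<Sum>s\<le>n. u z * ?T s z * (deriv ^^ (Suc (Suc n) - s)) f z)"
    by (simp add: vf_op_def sum.distrib ring_distribs sum_distrib_left Suc_diff_le mult_ac)
  \<comment> \<open>The added term \<open>s = Suc n\<close> vanishes. Splitting off
    \<open>s = 0\<close> instead then shifts the index, so that both sums carry the same derivatives
    of \<open>f\<close>.\<close>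
  also have "(\<Sum>s\<le>n. u z * ?T s z * (deriv ^^ (Suc (Suc n) - s)) f z) =
      (\<Sum>s\<le>Suc n. u z * ?T s z * (deriv ^^ (Suc (Suc n) - s)) f z)"
    by (simp add: diff_poly_def power_coeff_eq_0)
  also have "\<dots> = u z * ?T 0 z * (deriv ^^ Suc (Suc n)) f z +
      (\<Sum>s\<le>n. u z * ?T (Suc s) z * (deriv ^^ (Suc n - s)) f z)"
    by (subst sum.atMost_Suc_shift) simp
  also have "(\<Sum>s\<le>n. u z * ?T' s z * (deriv ^^ (Suc n - s)) f z) + \<dots> =
      u z * ?T 0 z * (deriv ^^ Suc (Suc n)) f z +
      (\<Sum>s\<le>n. u z * (?T (Suc s) z + ?T' s z) * (deriv ^^ (Suc n - s)) f z)"
    by (simp add: sum.distrib ring_distribs)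
  also have "\<dots> = (\<Sum>s\<le>Suc n. diff_poly (Suc (Suc n)) s (power_coeff (Suc n) s) u z *
                      (deriv ^^ (Suc (Suc n) - s)) f z)"
    by (subst sum.atMost_Suc_shift) (simp add: diff_poly_mult flip: diff_poly_add)
  finally show ?case .
qed

section \<open>Coefficients of two particular monomials\<close>

lemma power_coeff_leading: "power_coeff n 0 ((\<lambda>_. 0)(0 := Suc n)) = 1"
proof (induction n)
  case (Suc n)
  have "dec 0 ((\<lambda>_. 0)(0 := Suc (Suc n))) = (\<lambda>_. 0)(0 := Suc n)"
    by (auto simp: dec_def)
  with Suc show ?case by (simp add: mult_coeff_def del: fun_upd_apply) simp
qed simp

text \<open>The vector encodes \<open>u ^ n * D ^ (s + 1) u\<close>. After removal of one factor
  \<open>u\<close>, it arises from itself or by differentiating \<open>D ^ s u\<close>; the two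
  contributions add up by Pascal's rule.\<close>

lemma power_coeff_linear:
  "power_coeff n (Suc s) ((\<lambda>i. if i = Suc s then 1 else 0)(0 := n)) = of_nat (Suc n choose Suc (Suc s))"
proof (induction n arbitrary: s)
  case 0
  then show ?case by simp
next
  case (Suc n)
  let ?l = "\<lambda>n s. (\<lambda>i::nat. if i = Suc s then 1 else 0 :: nat)(0 := n)"
  have dec: "dec 0 (?l (Suc n) s) = ?l n s"
    by (auto simp: dec_def)
  \<comment> \<open>Apart from the index \<open>0\<close>, the only nonzero entry is at
    \<open>Suc s\<close>, so only \<open>j = s\<close> contributes.\<close>
  have "deriv_coeff s (power_coeff n s) (?l n s) =
      (\<Sum>j\<le>s. if j = s then (let \<alpha> = inc s (dec (Suc s) (?l n s)) in of_nat (\<alpha> s) * power_coeff n s \<alpha>) else 0)"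
    unfolding deriv_coeff_def by (intro sum.cong) auto
  also have "\<dots> = (let \<alpha> = inc s (dec (Suc s) (?l n s)) in of_nat (\<alpha> s) * power_coeff n s \<alpha>)"
    by simp
  also have "\<dots> = of_nat (Suc n choose Suc s)"
  proof (cases s)
    \<comment> \<open>The predecessor is \<open>u ^ (n + 1)\<close> with coefficient
      \<open>1\<close>; its exponent supplies \<open>Suc n choose 1\<close>. For
      \<open>s > 0\<close> the differentiated factor has exponent \<open>1\<close>.\<close>
    case s: 0
    have "inc 0 (dec (Suc 0) (?l n 0)) = (\<lambda>_. 0)(0 := Suc n)"
      by (auto simp: inc_def dec_def)
    then show ?thesis using s power_coeff_leading[of n] by simp
  next
    case s: (Suc t)
    have "inc s (dec (Suc s) (?l n s)) = ?l n t"
      using s by (auto simp: inc_def dec_def)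
    moreover have "?l n t s = 1" using s by simp
    ultimately show ?thesis using Suc.IH[of t] by (simp add: s Let_def del: fun_upd_apply binomial_Suc_Suc)
  qed
  finally show ?case
    using Suc.IH[of s] by (simp add: mult_coeff_def dec del: binomial_Suc_Suc fun_upd_apply)
      (simp add: binomial_Suc_Suc)
qed

section \<open>Linear independence of monomials\<close>

text \<open>By induction on the variables: as a polynomial in \<open>x j\<close> alone the sum
  vanishes everywhere, hence so does each coefficient, and the coefficient at exponent
  \<open>e a j\<close> is a sum of the same kind over \<open>I\<close>.\<close>

lemma monomials_linearly_independent:
  fixes c :: "'a \<Rightarrow> 'b :: {idom, ring_char_0}" and e :: "'a \<Rightarrow> 'i \<Rightarrow> nat"
  assumes "finite I" "finite S" "\<And>a b. a \<in> S \<Longrightarrow> b \<in> S \<Longrightarrow> \<forall>i\<in>I. e a i = e b i \<Longrightarrow> a = b"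
    and "\<And>x. (\<Sum>a\<in>S. c a * (\<Prod>i\<in>I. x i ^ e a i)) = 0" and "a \<in> S"
  shows "c a = 0"
  using assms
proof (induction I arbitrary: S a rule: finite_induct)
  case empty
  then have "S = {a}" by auto
  with empty show ?case by simp
next
  case (insert j I)
  let ?S = "{b\<in>S. e b j = e a j}"
  have "(\<Sum>b\<in>?S. c b * (\<Prod>i\<in>I. x i ^ e b i)) = 0" for x
  proof -
    let ?p = "\<Sum>b\<in>S. monom (c b * (\<Prod>i\<in>I. x i ^ e b i)) (e b j)"
    have "poly ?p t = 0" for t
    proof -
      have "(\<Prod>i\<in>I. (x(j := t)) i ^ e b i) = (\<Prod>i\<in>I. x i ^ e b i)" for b
        using insert.hyps by (intro prod.cong) auto
      then show ?thesis
        using insert.prems(3)[of "x(j := t)"] insert.hyps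
        by (simp add: poly_sum poly_monom mult_ac)
    qed
    then have "coeff ?p (e a j) = 0"
      using poly_all_0_iff_0 by (metis coeff_0)
    then show ?thesis
      using insert.prems(1) by (simp add: coeff_sum sum.If_cases Int_def cong: if_cong)
  qed
  moreover have "b = b'" if "b \<in> ?S" "b' \<in> ?S" "\<forall>i\<in>I. e b i = e b' i" for b b'
    using that by (intro insert.prems(2)) auto
  ultimately show ?case
    using insert.prems(1,4) by (intro insert.IH[of ?S a]) auto
qed

section \<open>Passage to multi-indices and existence\<close>

lemma finite_multi_indices: "finite (multi_indices s m)"
proof (rule finite_subset)
  show "multi_indices s m \<subseteq> {\<alpha>. \<forall>i. (i \<in> {1..s} \<longrightarrow> \<alpha> i \<in> {..m}) \<and> (i \<notin> {1..s} \<longrightarrow> \<alpha> i = 0)}"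
    by (auto simp: multi_indices_def intro: member_le_sum)
qed (rule finite_set_of_finite_funs; simp)

lemma atMost_eq_insert_0: "{..s} = insert 0 {1..s :: nat}"
  by auto

text \<open>Here \<open>m\<close> counts the factors that are proper derivatives, so
  \<open>u\<close> itself has exponent \<open>d - m\<close>. Since \<open>m \<le> s \<le> d\<close>,
  this difference is not truncated.\<close>

lemma diff_poly_eq_multi_indices_sum:
  assumes "1 \<le> s" "s \<le> d"
  shows "diff_poly d s c u z = (\<Sum>m=1..s. u z ^ (d - m) *
           (\<Sum>\<alpha>\<in>multi_indices s m. c (\<alpha>(0 := d - m)) * (\<Prod>i=1..s. ((deriv ^^ i) u z) ^ \<alpha> i)))"
proof -
  have "(\<Sum>m=1..s. u z ^ (d - m) *
           (\<Sum>\<alpha>\<in>multi_indices s m. c (\<alpha>(0 := d - m)) * (\<Prod>i=1..s. ((deriv ^^ i) u z) ^ \<alpha> i))) =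
        (\<Sum>(m, \<alpha>)\<in>Sigma {1..s} (multi_indices s). u z ^ (d - m) *
           (c (\<alpha>(0 := d - m)) * (\<Prod>i=1..s. ((deriv ^^ i) u z) ^ \<alpha> i)))"
    by (simp add: sum_distrib_left sum.Sigma finite_multi_indices)
  also have "\<dots> = (\<Sum>\<beta>\<in>exponents d s. c \<beta> * jet_monomial s \<beta> u z)"
  proof (rule sum.reindex_bij_witness[of _ "\<lambda>\<beta>. (d - \<beta> 0, \<beta>(0 := 0))" "\<lambda>(m, \<alpha>). \<alpha>(0 := d - m)"])
    fix x assume x: "x \<in> Sigma {1..s} (multi_indices s)"
    obtain m \<alpha> where [simp]: "x = (m, \<alpha>)" by (cases x)
    have m: "m \<le> d" "\<alpha> 0 = 0" "\<alpha> \<in> multi_indices s m"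
      using x assms by (auto simp: multi_indices_def)
    show "(case x of (m, \<alpha>) \<Rightarrow> \<alpha>(0 := d - m)) \<in> exponents d s"
      using m by (auto simp: exponents_def multi_indices_def atMost_eq_insert_0)
    show "(d - (case x of (m, \<alpha>) \<Rightarrow> \<alpha>(0 := d - m)) 0, (case x of (m, \<alpha>) \<Rightarrow> \<alpha>(0 := d - m))(0 := 0)) = x"
      using m by (auto simp: fun_eq_iff)
    show "c (case x of (m, \<alpha>) \<Rightarrow> \<alpha>(0 := d - m)) * jet_monomial s (case x of (m, \<alpha>) \<Rightarrow> \<alpha>(0 := d - m)) u z =
          (case x of (m, \<alpha>) \<Rightarrow> u z ^ (d - m) *
             (c (\<alpha>(0 := d - m)) * (\<Prod>i=1..s. ((deriv ^^ i) u z) ^ \<alpha> i)))"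
      by (simp add: jet_monomial_def atMost_eq_insert_0 mult_ac)
  next
    fix \<beta> assume \<beta>: "\<beta> \<in> exponents d s"
    have sums: "\<beta> 0 + (\<Sum>i=1..s. \<beta> i) = d" "(\<Sum>i=1..s. i * \<beta> i) = s" "\<forall>i>s. \<beta> i = 0"
      using \<beta> by (auto simp: exponents_def atMost_eq_insert_0)
    have "(\<Sum>i=1..s. \<beta> i) \<le> (\<Sum>i=1..s. i * \<beta> i)"
      by (intro sum_mono) auto
    \<comment> \<open>A positive weight requires a proper derivative, so
      \<open>m \<ge> 1\<close>.\<close>
    moreover have "(\<Sum>i=1..s. \<beta> i) \<noteq> 0"
    proof
      assume "(\<Sum>i=1..s. \<beta> i) = 0"
      then have "(\<Sum>i=1..s. i * \<beta> i) = 0" by simp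
      with sums(2) assms(1) show False by linarith
    qed
    moreover have "d - \<beta> 0 = (\<Sum>i=1..s. \<beta> i)"
      using sums(1) by linarith
    ultimately have "d - \<beta> 0 = (\<Sum>i=1..s. \<beta> i)" "(\<Sum>i=1..s. \<beta> i) \<in> {1..s}"
      using sums(2) unfolding atLeastAtMost_iff by linarith+
    then show "(d - \<beta> 0, \<beta>(0 := 0)) \<in> Sigma {1..s} (multi_indices s)"
      using sums(2,3) by (auto simp: multi_indices_def)
    show "(case (d - \<beta> 0, \<beta>(0 := 0)) of (m, \<alpha>) \<Rightarrow> \<alpha>(0 := d - m)) = \<beta>"
      using sums(1) by (auto simp: fun_eq_iff)
  qed
  finally show ?thesis by (simp add: diff_poly_def)
qed

lemma universal_coeffs_exist:
  "universal_coeffs (Suc n) (\<lambda>s m \<alpha>.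
     if 1 \<le> s \<and> s \<le> n \<and> 1 \<le> m \<and> m \<le> s \<and> \<alpha> \<in> multi_indices s m
     then power_coeff n s (\<alpha>(0 := Suc n - m)) else 0)" (is "universal_coeffs _ ?C")
  unfolding universal_coeffs_def
proof (intro allI impI)
  fix u f :: "complex \<Rightarrow> complex" and z
  assume "u analytic_on {z}" "f analytic_on {z}"
  then obtain e e' where e: "e > 0" "e' > 0" "u holomorphic_on ball z e" "f holomorphic_on ball z e'"
    by (auto simp: analytic_on_def)
  have "(vf_op u ^^ Suc n) f z =
      (\<Sum>s\<le>n. diff_poly (Suc n) s (power_coeff n s) u z * (deriv ^^ (Suc n - s)) f z)"
    \<comment> \<open>The smaller ball is a common domain of holomorphy of \<open>u\<close> and
      \<open>f\<close>.\<close>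
    using e by (intro vf_op_power[of "ball z (min e e')"])
               (auto intro: holomorphic_on_subset)
  also have "\<dots> = diff_poly (Suc n) 0 (power_coeff n 0) u z * (deriv ^^ Suc n) f z +
      (\<Sum>s=1..n. diff_poly (Suc n) s (power_coeff n s) u z * (deriv ^^ (Suc n - s)) f z)"
    by (simp add: atMost_eq_insert_0)
  also have "diff_poly (Suc n) 0 (power_coeff n 0) u z = u z ^ Suc n"
  proof -
    have "exponents (Suc n) 0 = {(\<lambda>_. 0)(0 := Suc n)}"
      by (auto simp: exponents_def)
    then show ?thesis
      using power_coeff_leading[of n] by (simp add: diff_poly_def jet_monomial_def)
  qed
  also have "(\<Sum>s=1..n. diff_poly (Suc n) s (power_coeff n s) u z * (deriv ^^ (Suc n - s)) f z) =
      (\<Sum>s=1..Suc n - 1. (\<Sum>m=1..s. u z ^ (Suc n - m) *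
         (\<Sum>\<alpha>\<in>multi_indices s m. ?C s m \<alpha> * (\<Prod>i=1..s. ((deriv ^^ i) u z) ^ \<alpha> i))) *
         (deriv ^^ (Suc n - s)) f z)"
    by (intro sum.cong arg_cong2[of _ _ _ _ "(*)"] refl)
       (auto simp: diff_poly_eq_multi_indices_sum intro!: sum.cong)
  finally show "(vf_op u ^^ Suc n) f z = u z ^ Suc n * (deriv ^^ Suc n) f z +
      (\<Sum>s=1..Suc n - 1. (\<Sum>m=1..s. u z ^ (Suc n - m) *
         (\<Sum>\<alpha>\<in>multi_indices s m. ?C s m \<alpha> * (\<Prod>i=1..s. ((deriv ^^ i) u z) ^ \<alpha> i))) *
         (deriv ^^ (Suc n - s)) f z)" .
qed

section \<open>Uniqueness by polynomial test functions\<close>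

lemma higher_deriv_poly: "(deriv ^^ n) (poly p) = poly ((pderiv ^^ n) p)"
  for p :: "complex poly"
proof (induction n)
  case (Suc n)
  have "deriv (poly q) = poly (pderiv q)" for q :: "complex poly"
    by (rule ext) (rule DERIV_imp_deriv[OF poly_DERIV])
  with Suc show ?case by simp
qed simp

lemma polynomial_with_jet:
  fixes a :: "nat \<Rightarrow> complex"
  obtains p where "\<And>i. i \<le> n \<Longrightarrow> (deriv ^^ i) (poly p) 0 = a i"
proof
  fix i assume "i \<le> n"
  \<comment> \<open>The Taylor polynomial at \<open>0\<close> with the prescribed
    derivatives.\<close>
  let ?p = "Poly (map (\<lambda>i. a i / fact i) [0..<Suc n])"
  have "coeff ?p i = a i / fact i"
    using \<open>i \<le> n\<close> by (simp add: nth_default_def del: upt_Suc)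
  then show "(deriv ^^ i) (poly ?p) 0 = a i"
    by (simp add: higher_deriv_poly poly_0_coeff_0 coeff_higher_pderiv pochhammer_fact[symmetric])
qed

text \<open>Evaluated at \<open>0\<close> on suitable polynomials, the identity isolates the terms
  of one \<open>s\<close> as a polynomial in a freely chosen jet \<open>a\<close>. Two families give
  the same values, so linear independence applies to their difference.\<close>

lemma universal_coeffs_unique:
  assumes "universal_coeffs k C" "universal_coeffs k C'"
    and "1 \<le> s" "s \<le> k - 1" "1 \<le> m" "m \<le> s" "\<alpha> \<in> multi_indices s m"
  shows "C s m \<alpha> = C' s m \<alpha>"
proof -
  let ?S = "Sigma {1..s} (multi_indices s)"
  let ?D = "\<lambda>(m, \<alpha>). C s m \<alpha> - C' s m \<alpha>"
  have "(\<Sum>x\<in>?S. ?D x * (\<Prod>i=1..s. a i ^ snd x i)) = 0" for a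
  proof -
    \<comment> \<open>The value \<open>1\<close> at \<open>0\<close> makes all powers of
      \<open>u\<close> equal to \<open>1\<close>, while the derivatives stay free.\<close>
    obtain p where p: "\<And>i. i \<le> s \<Longrightarrow> (deriv ^^ i) (poly p) 0 = (if i = 0 then 1 else a i)"
      using polynomial_with_jet[of s "\<lambda>i. if i = 0 then 1 else a i"] by metis
    \<comment> \<open>at \<open>0\<close>, only the term with \<open>D ^ (k - s)\<close> survives for this argument\<close>
    obtain q :: "complex poly" where q: "\<And>i. i \<le> k \<Longrightarrow> (deriv ^^ i) (poly q) 0 = (if i = k - s then 1 else 0)"
      using polynomial_with_jet[of k "\<lambda>i. if i = k - s then 1 else 0"] by metis
    let ?F = "\<lambda>C. (\<Sum>m=1..s. \<Sum>\<alpha>\<in>multi_indices s m. C s m \<alpha> * (\<Prod>i=1..s. a i ^ \<alpha> i))"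
    have val: "(vf_op (poly p) ^^ k) (poly q) 0 = ?F C" if "universal_coeffs k C" for C
    proof -
      have an: "poly r analytic_on A" for r :: "complex poly" and A
        by (rule analytic_on_subset[of _ UNIV])
           (auto simp: analytic_on_open holomorphic_on_def field_differentiable_def
                 intro: poly_DERIV has_field_derivative_at_within)
      let ?t = "\<lambda>s. (\<Sum>m=1..s. poly p 0 ^ (k - m) *
          (\<Sum>\<alpha>\<in>multi_indices s m. C s m \<alpha> * (\<Prod>i=1..s. ((deriv ^^ i) (poly p) 0) ^ \<alpha> i)))"
      have "(vf_op (poly p) ^^ k) (poly q) 0 =
          poly p 0 ^ k * (deriv ^^ k) (poly q) 0 + (\<Sum>s=1..k-1. ?t s * (deriv ^^ (k - s)) (poly q) 0)"
        using that an unfolding universal_coeffs_def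
        by (blast intro: analytic_on_imp_meromorphic_on)
      also have "(\<Sum>s=1..k-1. ?t s * (deriv ^^ (k - s)) (poly q) 0) =
          (\<Sum>s'=1..k-1. if s' = s then ?t s' else 0)"
        using assms(3,4) by (intro sum.cong) (auto simp: q)
      also have "\<dots> = ?t s" using assms(3,4) by simp
      also have "?t s = ?F C"
        using p[of 0] by (auto simp: p intro!: sum.cong prod.cong)
      \<comment> \<open>The leading term vanishes at \<open>0\<close>, since
        \<open>k \<noteq> k - s\<close>.\<close>
      finally show ?thesis using assms(3,4) by (simp add: q)
    qed
    have "?F C = ?F C'" using val[OF assms(1)] val[OF assms(2)] by simp
    then have "(\<Sum>m=1..s. \<Sum>\<alpha>\<in>multi_indices s m. (C s m \<alpha> - C' s m \<alpha>) * (\<Prod>i=1..s. a i ^ \<alpha> i)) = 0"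
      by (simp add: left_diff_distrib sum_subtractf)
    then show ?thesis
      by (simp add: sum.Sigma finite_multi_indices case_prod_unfold)
  qed
  \<comment> \<open>Distinct pairs give distinct monomials, since \<open>m\<close> is the sum of the
    entries of \<open>\<alpha>\<close>.\<close>
  moreover have "x = y" if x: "x \<in> ?S" and y: "y \<in> ?S" and eq: "\<forall>i\<in>{1..s}. snd x i = snd y i" for x y
  proof -
    have "snd x i = snd y i" for i
      using eq x y by (cases "i \<in> {1..s}") (auto simp: multi_indices_def)
    then have "snd x = snd y" by auto
    moreover have "fst x = (\<Sum>i=1..s. snd x i)" "fst y = (\<Sum>i=1..s. snd y i)"
      using x y by (auto simp: multi_indices_def)
    ultimately show "x = y" by (simp add: prod_eq_iff)
  qed
  ultimately have "?D (m, \<alpha>) = 0"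
    using assms(5-7)
    by (intro monomials_linearly_independent[where c = ?D and I = "{1..s}" and S = ?S and e = snd])
       (simp_all add: finite_multi_indices)
  then show ?thesis by simp
qed

section \<open>Identification of \<open>op_coeff\<close> and conclusion\<close>

text \<open>Existence and uniqueness at admissible indices, with the value \<open>0\<close> at all
  others, make the definite description in \<open>op_coeff\<close> denote the recursive
  family.\<close>

lemma op_coeff_eq:
  assumes "1 \<le> s" "s \<le> n" "1 \<le> m" "m \<le> s" "\<alpha> \<in> multi_indices s m"
  shows "op_coeff (Suc n) s m \<alpha> = power_coeff n s (\<alpha>(0 := Suc n - m))"
proof -
  let ?adm = "\<lambda>s m \<alpha>. 1 \<le> s \<and> s \<le> Suc n - 1 \<and> 1 \<le> m \<and> m \<le> s \<and> \<alpha> \<in> multi_indices s m"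
  let ?C = "\<lambda>s m \<alpha>. if 1 \<le> s \<and> s \<le> n \<and> 1 \<le> m \<and> m \<le> s \<and> \<alpha> \<in> multi_indices s m
              then power_coeff n s (\<alpha>(0 := Suc n - m)) else 0"
  have "op_coeff (Suc n) = ?C"
    unfolding op_coeff_def
  proof (rule the_equality)
    fix C assume C: "universal_coeffs (Suc n) C \<and> (\<forall>s m \<alpha>. \<not> ?adm s m \<alpha> \<longrightarrow> C s m \<alpha> = 0)"
    have "C s m \<alpha> = ?C s m \<alpha>" for s m \<alpha>
    proof (cases "?adm s m \<alpha>")
      case True
      then show ?thesis
        using C by (intro universal_coeffs_unique[OF _ universal_coeffs_exist]) auto
    next
      case False
      then have "C s m \<alpha> = 0" using C by blast
      moreover have "?C s m \<alpha> = 0" using False by (intro if_not_P) simp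
      ultimately show ?thesis by simp
    qed
    then show "C = ?C" by (intro ext)
  qed (use universal_coeffs_exist in auto)
  then show ?thesis using assms by simp
qed

theorem corollary3p1:
  fixes k s :: nat
  assumes "k \<ge> 1" and "1 \<le> s" and "s \<le> k"
  shows "op_coeff (k + 1) s 1 (\<lambda>i. if i = s then 1 else 0) = of_nat ((k + 1) choose (s + 1))"
proof -
  obtain t where s: "s = Suc t" using assms(2) by (cases s) auto
  have "(\<lambda>i. if i = s then 1 else 0) \<in> multi_indices s 1"
    using assms(2) by (auto simp: multi_indices_def if_distrib[of "\<lambda>x. _ * x"] cong: if_cong)
  \<comment> \<open>With \<open>m = 1\<close>, the exponent of \<open>u\<close> is
    \<open>Suc k - 1 = k\<close>.\<close>
  then have "op_coeff (Suc k) s 1 (\<lambda>i. if i = s then 1 else 0) =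
      power_coeff k s ((\<lambda>i. if i = s then 1 else 0)(0 := k))"
    using op_coeff_eq[of s k 1] assms by simp
  then show ?thesis using power_coeff_linear[of k t] s by simp
qed

end
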